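(* Every fin-intersecting MAD family on $\omega$ is pseudocompact.
   Context: An almost disjoint family on $\omega$ is an infinite set $\mathcal A$ of infinite subsets of $\omega$ such that $a\cap b$ is finite for all distinct $a,b\in\mathcal A$; it is MAD if it is not properly contained in any other almost disjoint family on $\omega$. A fin sequence is a function $C:\omega\to[\omega]^{<\omega}\setminus\{\emptyset\}$ with $C(n)\cap C(m)=\emptyset$ whenever $n\neq m$. A collection of sets is centered if every finite nonempty subcollection has infinite intersection. An almost disjoint family $\mathcal A$ is fin-intersecting if for every fin sequence $C$ there exists an infinite $I\subseteq\omega$ such that $\{\{n\in I: a\cap C(n)\neq\emptyset\}: a\in\mathcal A\}\setminus[I]^{<\omega}$ is centered, where $[I]^{<\omega}$ is the set of finite subsets of $I$. The space $\Psi(\mathcal A)$ is the set $\omega\cup\mathcal A$ (a disjoint union) with the topology having as a basis $\{\{n\}:n\in\omega\}\cup\{\{a\}\cup(a\setminus F): a\in\mathcal A,\ F\in[\omega]^{<\omega}\}$. For a $T_1$ space $X$, $\exp(X)$ is the set of nonempty closed subsets of $X$ with the Vietoris topology, i.e. the topology generated by all sets $U^+=\{F\in\exp(X): F\subseteq U\}$ and $U^-=\{F\in\exp(X): F\cap U\neq\emptyset\}$ for $U\subseteq X$ open. A topological space is pseudocompact if every continuous real-valued function on it is bounded. An almost disjoint family $\mathcal A$ is called pseudocompact if $\exp(\Psi(\mathcal A))$ is pseudocompact. *)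

theory Defs
  imports "HOL-Analysis.Analysis"
begin

definition almost_disjoint_family :: "nat set set \<Rightarrow> bool" where
  "almost_disjoint_family \<A> \<longleftrightarrow>
     infinite \<A> \<and> (\<forall>a\<in>\<A>. infinite a) \<and> (\<forall>a\<in>\<A>. \<forall>b\<in>\<A>. a \<noteq> b \<longrightarrow> finite (a \<inter> b))"

definition MAD_family :: "nat set set \<Rightarrow> bool" where
  "MAD_family \<A> \<longleftrightarrow>
     almost_disjoint_family \<A> \<and> \<not> (\<exists>\<B>. almost_disjoint_family \<B> \<and> \<A> \<subset> \<B>)"

definition fin_sequence :: "(nat \<Rightarrow> nat set) \<Rightarrow> bool" where
  "fin_sequence C \<longleftrightarrow>
     (\<forall>n. finite (C n) \<and> C n \<noteq> {}) \<and> (\<forall>n m. n \<noteq> m \<longrightarrow> C n \<inter> C m = {})"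

definition centered :: "'a set set \<Rightarrow> bool" where
  "centered \<S> \<longleftrightarrow> (\<forall>\<F>. finite \<F> \<and> \<F> \<noteq> {} \<and> \<F> \<subseteq> \<S> \<longrightarrow> infinite (\<Inter>\<F>))"

definition fin_intersecting :: "nat set set \<Rightarrow> bool" where
  "fin_intersecting \<A> \<longleftrightarrow>
     (\<forall>C. fin_sequence C \<longrightarrow>
        (\<exists>I. infinite I \<and> centered ({{n \<in> I. a \<inter> C n \<noteq> {}} |a. a \<in> \<A>} - Fpow I)))"

text \<open>The points of \<open>\<Psi>(\<A>)\<close> live in a sum type, so that the union of \<open>\<omega>\<close> and \<open>\<A>\<close> is disjoint:
  \<open>Inl n\<close> is the natural number \<open>n\<close> and \<open>Inr a\<close> is the member \<open>a\<close> of the family, regarded as a point.\<close>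

definition Psi_basis :: "nat set set \<Rightarrow> (nat + nat set) set set" where
  "Psi_basis \<A> =
     {{Inl n} |n. True} \<union> {insert (Inr a) (Inl ` (a - F)) |a F. a \<in> \<A> \<and> finite F}"

definition Psi :: "nat set set \<Rightarrow> (nat + nat set) topology" where
  "Psi \<A> = topology_generated_by (Psi_basis \<A>)"

definition closed_hyperspace :: "'a topology \<Rightarrow> 'a set set" where
  "closed_hyperspace X = {F. closedin X F \<and> F \<noteq> {}}"

definition vietoris :: "'a topology \<Rightarrow> 'a set topology" where
  "vietoris X = topology_generated_by
     ({{F \<in> closed_hyperspace X. F \<subseteq> U} |U. openin X U} \<union>
      {{F \<in> closed_hyperspace X. F \<inter> U \<noteq> {}} |U. openin X U})"

definition pseudocompact_space :: "'a topology \<Rightarrow> bool" where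
  "pseudocompact_space X \<longleftrightarrow>
     (\<forall>f. continuous_map X euclideanreal f \<longrightarrow> bounded (f ` topspace X))"

definition pseudocompact_family :: "nat set set \<Rightarrow> bool" where
  "pseudocompact_family \<A> \<longleftrightarrow> pseudocompact_space (vietoris (Psi \<A>))"

text \<open>The generating family of \<open>Psi \<A>\<close> is a basis, not merely a subbasis; the carriers are the
  intended ones; and \<open>Psi \<A>\<close> is a \<open>T\<^sub>1\<close> space.\<close>

lemma topspace_Psi: "topspace (Psi \<A>) = range Inl \<union> Inr ` \<A>"
  unfolding Psi_def Psi_basis_def topology_generated_by_topspace by auto

lemma openin_Psi_iff:
  "openin (Psi \<A>) U \<longleftrightarrow> (\<forall>x\<in>U. \<exists>B\<in>Psi_basis \<A>. x \<in> B \<and> B \<subseteq> U)"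
proof
  assume "openin (Psi \<A>) U"
  then have "generate_topology_on (Psi_basis \<A>) U"
    unfolding Psi_def by (rule openin_topology_generated_by)
  then show "\<forall>x\<in>U. \<exists>B\<in>Psi_basis \<A>. x \<in> B \<and> B \<subseteq> U"
  proof induction
    case Empty
    show ?case by simp
  next
    case (Int S T)
    show ?case
    proof
      fix x assume x: "x \<in> S \<inter> T"
      show "\<exists>B\<in>Psi_basis \<A>. x \<in> B \<and> B \<subseteq> S \<inter> T"
      proof (cases x)
        case (Inl n)
        have "{Inl n} \<in> Psi_basis \<A>" unfolding Psi_basis_def by blast
        then show ?thesis using Inl x by blast
      next
        case (Inr a)
        obtain B1 B2 where B: "B1 \<in> Psi_basis \<A>" "Inr a \<in> B1" "B1 \<subseteq> S"
          "B2 \<in> Psi_basis \<A>" "Inr a \<in> B2" "B2 \<subseteq> T"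
          using Int.IH x Inr by blast
        obtain F where F: "a \<in> \<A>" "finite F" "B1 = insert (Inr a) (Inl ` (a - F))"
          using B(1,2) unfolding Psi_basis_def by auto
        obtain G where G: "finite G" "B2 = insert (Inr a) (Inl ` (a - G))"
          using B(4,5) unfolding Psi_basis_def by auto
        have "insert (Inr a) (Inl ` (a - (F \<union> G))) \<in> Psi_basis \<A>"
          unfolding Psi_basis_def using F(1,2) G(1) by blast
        moreover have "insert (Inr a) (Inl ` (a - (F \<union> G))) \<subseteq> S \<inter> T"
          using B(3,6) F(3) G(2) by blast
        ultimately show ?thesis using Inr by blast
      qed
    qed
  next
    case (UN K)
    then show ?case by (meson Union_iff Union_upper subset_trans)
  next
    case (Basis S)
    then show ?case by blast
  qed
next
  assume *: "\<forall>x\<in>U. \<exists>B\<in>Psi_basis \<A>. x \<in> B \<and> B \<subseteq> U"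
  then have U: "U = \<Union>{B \<in> Psi_basis \<A>. B \<subseteq> U}" by blast
  have "openin (Psi \<A>) (\<Union>{B \<in> Psi_basis \<A>. B \<subseteq> U})"
    by (rule openin_Union) (auto simp: Psi_def intro: topology_generated_by_Basis)
  then show "openin (Psi \<A>) U" using U by simp
qed

lemma t1_space_Psi: "t1_space (Psi \<A>)"
proof -
  have "closedin (Psi \<A>) {x}" if x: "x \<in> topspace (Psi \<A>)" for x
  proof -
    have "\<exists>B\<in>Psi_basis \<A>. y \<in> B \<and> B \<subseteq> topspace (Psi \<A>) - {x}"
      if y: "y \<in> topspace (Psi \<A>) - {x}" for y
    proof (cases y)
      case (Inl n)
      have "{Inl n} \<in> Psi_basis \<A>" unfolding Psi_basis_def by blast
      then show ?thesis using Inl y by blast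
    next
      case (Inr a)
      define F where "F = {n. x = Inl n}"
      have "F \<subseteq> {projl x}" unfolding F_def by auto
      then have "finite F" using finite_subset by blast
      moreover have a: "a \<in> \<A>" using y Inr unfolding topspace_Psi by auto
      ultimately have "insert (Inr a) (Inl ` (a - F)) \<in> Psi_basis \<A>"
        unfolding Psi_basis_def by blast
      moreover have "insert (Inr a) (Inl ` (a - F)) \<subseteq> topspace (Psi \<A>) - {x}"
        using y Inr a unfolding topspace_Psi F_def by auto
      ultimately show ?thesis using Inr by blast
    qed
    then have "openin (Psi \<A>) (topspace (Psi \<A>) - {x})"
      unfolding openin_Psi_iff by blast
    then show ?thesis using x by (simp add: closedin_def)
  qed
  then show ?thesis by (simp add: t1_space_closedin_singleton)
qed

lemma topspace_vietoris: "topspace (vietoris X) = closed_hyperspace X"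
proof -
  have "closed_hyperspace X = {F \<in> closed_hyperspace X. F \<subseteq> topspace X}"
    unfolding closed_hyperspace_def using closedin_subset by blast
  then show ?thesis
    unfolding vietoris_def topology_generated_by_topspace by blast
qed

end

theory Submission
  imports Defs
begin

text \<open>
  Nonempty finite subsets of \<open>\<omega>\<close> form a dense set in \<open>exp(\<Psi>(\<A>))\<close>, because \<open>\<omega>\<close> is dense in
  \<open>\<Psi>(\<A>)\<close>. An unbounded continuous function would therefore tend to infinity in absolute value along
  some sequence \<open>C\<close> of such sets. This is impossible at an accumulation point of \<open>C\<close>, near which the
  function is bounded, so it suffices to give every such sequence an accumulation point.

  The sets \<open>C n\<close> need not be disjoint, so the hypothesis on \<open>\<A>\<close> does not apply to them directly.
  By compactness of the Cantor space they have a pointwise limit \<open>L\<close> along a subsequence, and this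
  subsequence can be thinned out until the remainders \<open>D k = C (r k) - L\<close> are pairwise disjoint and
  are either all empty or all nonempty. If all are empty, then the closure of \<open>L\<close> is an accumulation
  point. Otherwise \<open>D\<close> is a fin sequence; let \<open>I\<close> be an index set as in the definition of
  fin-intersecting families, and let \<open>G\<close> be the set of all \<open>a\<close> in \<open>\<A>\<close> that meet \<open>D n\<close> for infinitely
  many \<open>n\<close> in \<open>I\<close>. The closure of \<open>L\<close> together with the points of \<open>G\<close> is an accumulation point:
  maximality of \<open>\<A>\<close> forces almost all \<open>D n\<close> with \<open>n\<close> in \<open>I\<close> into any open set containing \<open>G\<close>, and
  centeredness makes infinitely many of them meet all members of any given finite collection of open
  sets that meet \<open>G\<close>.
\<close>

section \<open>Open sets of \<open>\<Psi>(\<A>)\<close> and of the hyperspace\<close>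

lemma openin_Psi_Inr_almost_contains:
  assumes "openin (Psi \<A>) U" and "Inr a \<in> U"
  shows "finite {x \<in> a. Inl x \<notin> U}"
proof -
  obtain B where B: "B \<in> Psi_basis \<A>" "Inr a \<in> B" "B \<subseteq> U"
    using assms unfolding openin_Psi_iff by blast
  then obtain F where "finite F" "B = insert (Inr a) (Inl ` (a - F))"
    unfolding Psi_basis_def by auto
  with B have "{x \<in> a. Inl x \<notin> U} \<subseteq> F" by auto
  with \<open>finite F\<close> show ?thesis by (rule rev_finite_subset)
qed

lemma openin_Psi_meets_omega:
  assumes inf: "\<And>a. a \<in> \<A> \<Longrightarrow> infinite a" and U: "openin (Psi \<A>) U" "U \<noteq> {}"
  shows "\<exists>n. Inl n \<in> U"
proof -
  obtain x where x: "x \<in> U" using U by blast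
  show ?thesis
  proof (cases x)
    case (Inl n)
    then show ?thesis using x by blast
  next
    case (Inr a)
    then have "a \<in> \<A>" using x openin_subset[OF U(1)] by (auto simp: topspace_Psi)
    then have "infinite a" by (rule inf)
    moreover have "finite {n \<in> a. Inl n \<notin> U}"
      using openin_Psi_Inr_almost_contains[OF U(1)] x Inr by blast
    ultimately have "infinite (a - {n \<in> a. Inl n \<notin> U})" by (rule Diff_infinite_finite[rotated])
    then show ?thesis using infinite_imp_nonempty by blast
  qed
qed

lemma closedin_Psi_Inr_image:
  assumes "G \<subseteq> \<A>"
  shows "closedin (Psi \<A>) (Inr ` G)"
proof -
  have "\<exists>B\<in>Psi_basis \<A>. x \<in> B \<and> B \<subseteq> topspace (Psi \<A>) - Inr ` G"
    if x: "x \<in> topspace (Psi \<A>) - Inr ` G" for x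
  proof (cases x)
    case (Inl n)
    have "{Inl n} \<in> Psi_basis \<A>" unfolding Psi_basis_def by blast
    then show ?thesis using Inl x by blast
  next
    case (Inr a)
    then have "a \<in> \<A>" "a \<notin> G" using x by (auto simp: topspace_Psi)
    then have "insert (Inr a) (Inl ` (a - {})) \<in> Psi_basis \<A>"
      unfolding Psi_basis_def by blast
    moreover have "insert (Inr a) (Inl ` (a - {})) \<subseteq> topspace (Psi \<A>) - Inr ` G"
      using \<open>a \<in> \<A>\<close> \<open>a \<notin> G\<close> by (auto simp: topspace_Psi)
    moreover have "x \<in> insert (Inr a) (Inl ` (a - {}))" using Inr by simp
    ultimately show ?thesis by (intro bexI[rotated] conjI)
  qed
  then have "openin (Psi \<A>) (topspace (Psi \<A>) - Inr ` G)"
    unfolding openin_Psi_iff by blast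
  then show ?thesis using assms by (auto simp: closedin_def topspace_Psi)
qed

lemma finite_subset_of_omega_in_hyperspace:
  assumes "finite F" "F \<noteq> {}"
  shows "Inl ` F \<in> closed_hyperspace (Psi \<A>)"
  using assms t1_space_Psi[of \<A>]
  by (auto simp: closed_hyperspace_def t1_space_closedin_finite topspace_Psi)

lemma vietoris_basic_neighbourhood:
  assumes "openin (vietoris X) W" and "H \<in> W"
  obtains U \<V> where "openin X U" "finite \<V>" "\<And>V. V \<in> \<V> \<Longrightarrow> openin X V"
    "H \<subseteq> U" "\<And>V. V \<in> \<V> \<Longrightarrow> H \<inter> V \<noteq> {}"
    "{F \<in> closed_hyperspace X. F \<subseteq> U \<and> (\<forall>V\<in>\<V>. F \<inter> V \<noteq> {})} \<subseteq> W"
proof -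
  have "generate_topology_on
     ({{F \<in> closed_hyperspace X. F \<subseteq> U} |U. openin X U} \<union>
      {{F \<in> closed_hyperspace X. F \<inter> U \<noteq> {}} |U. openin X U}) W"
    using assms(1) unfolding vietoris_def by (rule openin_topology_generated_by)
  then have "\<exists>U \<V>. openin X U \<and> finite \<V> \<and> (\<forall>V\<in>\<V>. openin X V) \<and>
           H \<subseteq> U \<and> (\<forall>V\<in>\<V>. H \<inter> V \<noteq> {}) \<and>
           {F \<in> closed_hyperspace X. F \<subseteq> U \<and> (\<forall>V\<in>\<V>. F \<inter> V \<noteq> {})} \<subseteq> W"
    using assms(2)
  proof induction
    case Empty
    then show ?case by simp
  next
    case (Int S T)
    obtain U1 \<V>1 where 1: "openin X U1" "finite \<V>1" "\<forall>V\<in>\<V>1. openin X V"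
        "H \<subseteq> U1" "\<forall>V\<in>\<V>1. H \<inter> V \<noteq> {}"
        "{F \<in> closed_hyperspace X. F \<subseteq> U1 \<and> (\<forall>V\<in>\<V>1. F \<inter> V \<noteq> {})} \<subseteq> S"
      using Int by auto
    obtain U2 \<V>2 where 2: "openin X U2" "finite \<V>2" "\<forall>V\<in>\<V>2. openin X V"
        "H \<subseteq> U2" "\<forall>V\<in>\<V>2. H \<inter> V \<noteq> {}"
        "{F \<in> closed_hyperspace X. F \<subseteq> U2 \<and> (\<forall>V\<in>\<V>2. F \<inter> V \<noteq> {})} \<subseteq> T"
      using Int by auto
    have "openin X (U1 \<inter> U2)" "finite (\<V>1 \<union> \<V>2)" "\<forall>V\<in>\<V>1 \<union> \<V>2. openin X V"
      "H \<subseteq> U1 \<inter> U2" "\<forall>V\<in>\<V>1 \<union> \<V>2. H \<inter> V \<noteq> {}"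
      using 1 2 by auto
    moreover have "{F \<in> closed_hyperspace X. F \<subseteq> U1 \<inter> U2 \<and> (\<forall>V\<in>\<V>1 \<union> \<V>2. F \<inter> V \<noteq> {})}
        \<subseteq> S \<inter> T"
      using 1(6) 2(6) by blast
    ultimately show ?case by blast
  next
    case (UN K)
    then obtain k where k: "k \<in> K" "H \<in> k" by blast
    show ?case using UN.IH[OF k] k(1) by (meson Union_upper subset_trans)
  next
    case (Basis S)
    then consider U where "openin X U" "S = {F \<in> closed_hyperspace X. F \<subseteq> U}"
      | V where "openin X V" "S = {F \<in> closed_hyperspace X. F \<inter> V \<noteq> {}}"
      by blast
    then show ?case
    proof cases
      case (1 U)
      then show ?thesis using Basis.prems by (intro exI[of _ U] exI[of _ "{}"]) auto
    next
      case (2 V)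
      have "H \<subseteq> topspace X"
        using Basis.prems 2 closedin_subset by (auto simp: closed_hyperspace_def)
      then show ?thesis using Basis.prems 2
        by (intro exI[of _ "topspace X"] exI[of _ "{V}"]) auto
    qed
  qed
  then show thesis
    by (elim exE conjE) (rule that, assumption+, (erule (1) bspec | assumption)+)
qed

lemma finite_subsets_of_omega_dense:
  assumes inf: "\<And>a. a \<in> \<A> \<Longrightarrow> infinite a"
    and W: "openin (vietoris (Psi \<A>)) W" "W \<noteq> {}"
  shows "\<exists>F. finite F \<and> F \<noteq> {} \<and> Inl ` F \<in> W"
proof -
  obtain H where H: "H \<in> W" using W(2) by blast
  then have "H \<in> closed_hyperspace (Psi \<A>)"
    using openin_subset[OF W(1)] by (auto simp: topspace_vietoris)
  then have Hne: "H \<noteq> {}" by (auto simp: closed_hyperspace_def)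
  obtain U \<V> where UV: "openin (Psi \<A>) U" "finite \<V>" "\<And>V. V \<in> \<V> \<Longrightarrow> openin (Psi \<A>) V"
      "H \<subseteq> U" "\<And>V. V \<in> \<V> \<Longrightarrow> H \<inter> V \<noteq> {}"
      "{F \<in> closed_hyperspace (Psi \<A>). F \<subseteq> U \<and> (\<forall>V\<in>\<V>. F \<inter> V \<noteq> {})} \<subseteq> W"
    by (rule vietoris_basic_neighbourhood[OF W(1) H]) blast
  obtain n0 where n0: "Inl n0 \<in> U"
    using openin_Psi_meets_omega[OF inf UV(1)] UV(4) Hne by blast
  have "\<exists>n. Inl n \<in> U \<inter> V" if "V \<in> \<V>" for V
  proof (rule openin_Psi_meets_omega[OF inf])
    show "openin (Psi \<A>) (U \<inter> V)" using UV(1,3) that by blast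
    show "U \<inter> V \<noteq> {}" using UV(4,5) that by blast
  qed
  then obtain p where p: "\<And>V. V \<in> \<V> \<Longrightarrow> Inl (p V) \<in> U \<inter> V" by metis
  define F where "F = insert n0 (p ` \<V>)"
  have F: "finite F" "F \<noteq> {}" using UV(2) by (auto simp: F_def)
  moreover have "Inl ` F \<subseteq> U" "\<forall>V\<in>\<V>. Inl ` F \<inter> V \<noteq> {}"
    using n0 p by (auto simp: F_def)
  ultimately have "Inl ` F \<in> W"
    using UV(6) finite_subset_of_omega_in_hyperspace[OF F] by blast
  with F show ?thesis by blast
qed

section \<open>Accumulation points of sequences of finite sets\<close>

text \<open>A sufficient condition for \<open>cl(L) \<union> G\<close> to be an accumulation point of \<open>E\<close> in the hyperspace.
  Vietoris neighbourhoods impose one containment and finitely many intersection requirements.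
  The latter are of two kinds: an open set meeting \<open>cl(L)\<close> meets \<open>L\<close> itself, so eventually it meets
  \<open>E n\<close>; an open set containing a point \<open>a\<close> of \<open>G\<close> contains \<open>a\<close> up to a finite set, and these finite
  errors are collected in \<open>K\<close>.\<close>

lemma vietoris_accumulation_point:
  assumes E: "\<And>n. finite (E n)" "\<And>n. E n \<noteq> {}"
    and L: "\<And>x. x \<in> L \<Longrightarrow> finite {n \<in> I. x \<notin> E n}"
    and G: "G \<subseteq> \<A>" and ne: "L \<noteq> {} \<or> G \<noteq> {}"
    and cover: "\<And>U. \<lbrakk>openin (Psi \<A>) U; Inl ` L \<subseteq> U; Inr ` G \<subseteq> U\<rbrakk>
                  \<Longrightarrow> finite {n \<in> I. \<not> Inl ` E n \<subseteq> U}"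
    and hit: "\<And>\<F> K. \<lbrakk>finite \<F>; \<F> \<subseteq> G; finite K\<rbrakk>
                  \<Longrightarrow> infinite {n \<in> I. \<forall>a\<in>\<F>. a \<inter> E n - K \<noteq> {}}"
  shows "\<exists>H\<in>closed_hyperspace (Psi \<A>).
           \<forall>W. openin (vietoris (Psi \<A>)) W \<and> H \<in> W \<longrightarrow> infinite {n. Inl ` E n \<in> W}"
proof
  define H where "H = (Psi \<A> closure_of (Inl ` L)) \<union> Inr ` G"
  have sub: "Inl ` L \<subseteq> Psi \<A> closure_of (Inl ` L)"
    by (rule closure_of_subset) (auto simp: topspace_Psi)
  have "closedin (Psi \<A>) H"
    unfolding H_def using closedin_Psi_Inr_image[OF G] by (intro closedin_Un) auto
  moreover have "H \<noteq> {}" using ne sub by (auto simp: H_def)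
  ultimately show "H \<in> closed_hyperspace (Psi \<A>)" by (simp add: closed_hyperspace_def)
  show "\<forall>W. openin (vietoris (Psi \<A>)) W \<and> H \<in> W \<longrightarrow> infinite {n. Inl ` E n \<in> W}"
  proof (intro allI impI, elim conjE)
    fix W assume W: "openin (vietoris (Psi \<A>)) W" "H \<in> W"
    obtain U \<V> where UV: "openin (Psi \<A>) U" "finite \<V>" "\<And>V. V \<in> \<V> \<Longrightarrow> openin (Psi \<A>) V"
        "H \<subseteq> U" "\<And>V. V \<in> \<V> \<Longrightarrow> H \<inter> V \<noteq> {}"
        "{F \<in> closed_hyperspace (Psi \<A>). F \<subseteq> U \<and> (\<forall>V\<in>\<V>. F \<inter> V \<noteq> {})} \<subseteq> W"
      by (rule vietoris_basic_neighbourhood[OF W]) blast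
    define \<V>L where "\<V>L = {V \<in> \<V>. Inl ` L \<inter> V \<noteq> {}}"
    have "\<exists>a\<in>G. Inr a \<in> V" if V: "V \<in> \<V> - \<V>L" for V
    proof -
      have "Inl ` L \<inter> V = {}" "openin (Psi \<A>) V" using V UV(3) by (auto simp: \<V>L_def)
      then have "(Psi \<A> closure_of (Inl ` L)) \<inter> V = {}"
        by (metis Int_commute openin_Int_closure_of_eq_empty)
      with UV(5)[of V] V show ?thesis by (auto simp: H_def)
    qed
    then obtain p where p: "\<And>V. V \<in> \<V> - \<V>L \<Longrightarrow> p V \<in> G \<and> Inr (p V) \<in> V" by metis
    have "\<exists>x\<in>L. Inl x \<in> V" if "V \<in> \<V>L" for V using that by (auto simp: \<V>L_def)
    then obtain q where q: "\<And>V. V \<in> \<V>L \<Longrightarrow> q V \<in> L \<and> Inl (q V) \<in> V" by metis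
    define K where "K = (\<Union>V\<in>\<V> - \<V>L. {x \<in> p V. Inl x \<notin> V})"
    have K: "finite K"
      unfolding K_def
    proof (rule finite_UN_I)
      show "finite (\<V> - \<V>L)" using UV(2) by simp
      show "finite {x \<in> p V. Inl x \<notin> V}" if "V \<in> \<V> - \<V>L" for V
        using UV(3) p[OF that] that by (intro openin_Psi_Inr_almost_contains) auto
    qed
    define Good where "Good = {n \<in> I. \<forall>a\<in>p ` (\<V> - \<V>L). a \<inter> E n - K \<noteq> {}}"
    define Bad where "Bad = {n \<in> I. \<not> Inl ` E n \<subseteq> U} \<union> (\<Union>V\<in>\<V>L. {n \<in> I. q V \<notin> E n})"
    have "infinite Good"
      unfolding Good_def using UV(2) p K by (intro hit) auto
    moreover have "finite Bad"
    proof -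
      have "finite {n \<in> I. \<not> Inl ` E n \<subseteq> U}"
        using UV(1,4) sub by (intro cover) (auto simp: H_def)
      moreover have "finite \<V>L" using UV(2) by (simp add: \<V>L_def)
      ultimately show ?thesis using q L by (auto simp: Bad_def)
    qed
    ultimately have "infinite (Good - Bad)" by simp
    moreover have "Good - Bad \<subseteq> {n. Inl ` E n \<in> W}"
    proof
      fix n assume n: "n \<in> Good - Bad"
      then have "Inl ` E n \<subseteq> U" by (auto simp: Good_def Bad_def)
      moreover have "Inl ` E n \<inter> V \<noteq> {}" if V: "V \<in> \<V>" for V
      proof (cases "V \<in> \<V>L")
        case True
        then have "q V \<in> E n" using n by (auto simp: Good_def Bad_def)
        with q[OF True] show ?thesis by blast
      next
        case False
        then have "p V \<inter> E n - K \<noteq> {}" using n V by (auto simp: Good_def)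
        then obtain x where x: "x \<in> p V" "x \<in> E n" "x \<notin> K" by blast
        then have "Inl x \<in> V" using V False by (auto simp: K_def)
        with x show ?thesis by blast
      qed
      ultimately have "Inl ` E n \<in>
          {F \<in> closed_hyperspace (Psi \<A>). F \<subseteq> U \<and> (\<forall>V\<in>\<V>. F \<inter> V \<noteq> {})}"
        using finite_subset_of_omega_in_hyperspace[OF E] by simp
      from subsetD[OF UV(6) this] show "n \<in> {n. Inl ` E n \<in> W}" by simp
    qed
    ultimately show "infinite {n. Inl ` E n \<in> W}" by (rule infinite_super[rotated])
  qed
qed

section \<open>Consequences of maximality\<close>

lemma MAD_family_meets_infinite_set:
  assumes "MAD_family \<A>" and X: "infinite X"
  shows "\<exists>a\<in>\<A>. infinite (a \<inter> X)"
proof (rule ccontr)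
  assume *: "\<not> ?thesis"
  have ad: "almost_disjoint_family \<A>" using assms by (simp add: MAD_family_def)
  have "X \<notin> \<A>" using * X by auto
  moreover have "almost_disjoint_family (insert X \<A>)"
    using ad * X unfolding almost_disjoint_family_def by (auto simp: Int_commute)
  ultimately show False using assms(1) unfolding MAD_family_def by blast
qed

text \<open>Apply maximality to the union of the \<open>B n\<close>; as each \<open>B n\<close> is finite, infinitely many of them are
  needed to cover the points of \<open>a\<close>. The second conjunct is kept for the case in which the \<open>B n\<close> are
  the parts of larger sets outside an open set: then the open set cannot contain the point \<open>a\<close>.\<close>

lemma MAD_family_meets_disjoint_finite_sets:
  assumes mad: "MAD_family \<A>" and fin: "\<And>n. finite (B n)"
    and disj: "\<And>m n. m \<noteq> n \<Longrightarrow> B m \<inter> B n = {}"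
    and inf: "infinite {n \<in> I. B n \<noteq> {}}"
  shows "\<exists>a\<in>\<A>. infinite {n \<in> I. a \<inter> B n \<noteq> {}} \<and> infinite (a \<inter> (\<Union>n\<in>I. B n))"
proof -
  have "\<exists>x. x \<in> B n" if "n \<in> {n \<in> I. B n \<noteq> {}}" for n using that by auto
  then obtain x where x: "\<And>n. n \<in> {n \<in> I. B n \<noteq> {}} \<Longrightarrow> x n \<in> B n" by metis
  have "inj_on x {n \<in> I. B n \<noteq> {}}"
    using x disj by (intro inj_onI) (metis disjoint_iff)
  then have "infinite (x ` {n \<in> I. B n \<noteq> {}})" using inf finite_imageD by blast
  moreover have "x ` {n \<in> I. B n \<noteq> {}} \<subseteq> (\<Union>n\<in>I. B n)" using x by auto
  ultimately have "infinite (\<Union>n\<in>I. B n)" using finite_subset by blast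
  then obtain a where a: "a \<in> \<A>" "infinite (a \<inter> (\<Union>n\<in>I. B n))"
    using MAD_family_meets_infinite_set[OF mad] by blast
  have "a \<inter> (\<Union>n\<in>I. B n) \<subseteq> (\<Union>n\<in>{n \<in> I. a \<inter> B n \<noteq> {}}. B n)" by auto
  then have "infinite {n \<in> I. a \<inter> B n \<noteq> {}}" using a(2) fin by (meson finite_UN_I finite_subset)
  with a show ?thesis by blast
qed

section \<open>Reduction to disjoint remainders\<close>

text \<open>Sequential compactness of the Cantor space. The initial segments of \<open>L\<close> are chosen one bit at
  a time, keeping the set of indices that agree with the choice infinite.\<close>

lemma infinitely_often_pointwise_limit:
  fixes C :: "nat \<Rightarrow> nat set"
  shows "\<exists>L. \<forall>m. infinite {n. C n \<inter> {..<m} = L \<inter> {..<m}}"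
proof -
  have "\<exists>S. \<forall>m. (S m \<subseteq> {..<m} \<and> infinite {n. C n \<inter> {..<m} = S m}) \<and> S (Suc m) \<inter> {..<m} = S m"
  proof (rule dependent_nat_choice)
    show "\<exists>S. S \<subseteq> {..<0} \<and> infinite {n. C n \<inter> {..<0} = S}" by auto
  next
    fix T m assume T: "T \<subseteq> {..<m::nat} \<and> infinite {n. C n \<inter> {..<m} = T}"
    have "{n. C n \<inter> {..<m} = T} \<subseteq>
        {n. C n \<inter> {..<Suc m} = T} \<union> {n. C n \<inter> {..<Suc m} = insert m T}"
      by (auto simp: lessThan_Suc)
    then have "infinite {n. C n \<inter> {..<Suc m} = T} \<or> infinite {n. C n \<inter> {..<Suc m} = insert m T}"
      using T by (meson finite_UnI finite_subset)
    then show "\<exists>S. (S \<subseteq> {..<Suc m} \<and> infinite {n. C n \<inter> {..<Suc m} = S}) \<and> S \<inter> {..<m} = T"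
    proof
      assume "infinite {n. C n \<inter> {..<Suc m} = T}"
      then show ?thesis using T by (intro exI[of _ T]) auto
    next
      assume "infinite {n. C n \<inter> {..<Suc m} = insert m T}"
      then show ?thesis using T by (intro exI[of _ "insert m T"]) auto
    qed
  qed
  then obtain S where S: "\<And>m. S m \<subseteq> {..<m}" "\<And>m. infinite {n. C n \<inter> {..<m} = S m}"
      "\<And>m. S (Suc m) \<inter> {..<m} = S m" by metis
  have coh: "S (m + d) \<inter> {..<m} = S m" for m d
  proof (induction d)
    case 0
    then show ?case using S(1)[of m] by auto
  next
    case (Suc d)
    have "S (m + Suc d) \<inter> {..<m} = S (Suc (m + d)) \<inter> {..<m + d} \<inter> {..<m}" by auto
    then show ?case using S(3) Suc by simp
  qed
  have "(\<Union>k. S k) \<inter> {..<m} = S m" for m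
  proof
    show "(\<Union>k. S k) \<inter> {..<m} \<subseteq> S m"
    proof
      fix x assume "x \<in> (\<Union>k. S k) \<inter> {..<m}"
      then obtain k where k: "x \<in> S k" "x < m" by auto
      have "x \<in> S (k + m)" using coh[of k m] k by blast
      then show "x \<in> S m" using coh[of m k] k by (auto simp: add.commute)
    qed
    show "S m \<subseteq> (\<Union>k. S k) \<inter> {..<m}" using S(1)[of m] by auto
  qed
  then show ?thesis using S(2) by (intro exI[of _ "\<Union>k. S k"]) simp
qed

text \<open>Each set of the subsequence is chosen to agree with \<open>L\<close> below a bound for all earlier ones, so its
  points outside \<open>L\<close> lie above everything in those. The predicate \<open>Q\<close> serves to make the remainders
  uniformly empty or uniformly nonempty.\<close>

lemma subsequence_with_disjoint_remainders:
  fixes C :: "nat \<Rightarrow> nat set"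
  assumes fin: "\<And>n. finite (C n)"
    and lim: "\<And>m. infinite {n. C n \<inter> {..<m} = L \<inter> {..<m} \<and> Q n}"
  obtains r :: "nat \<Rightarrow> nat" where "strict_mono r" "\<And>k. Q (r k)"
    "\<And>x. x \<in> L \<Longrightarrow> finite {k. x \<notin> C (r k)}"
    "\<And>j k. j \<noteq> k \<Longrightarrow> (C (r j) - L) \<inter> (C (r k) - L) = {}"
proof -
  \<comment> \<open>Taking the bound over all earlier sets makes it monotone; it exceeds \<open>n\<close> so that agreement with
    \<open>L\<close> below it becomes pointwise convergence.\<close>
  define g where "g n = Suc (Max (insert n (\<Union>i\<le>n. C i)))" for n
  have finM: "finite (insert n (\<Union>i\<le>n. C i))" for n using fin by auto
  have g_n: "n < g n" for n using finM[of n] by (simp add: g_def less_Suc_eq_le)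
  have g_C: "x < g n" if "x \<in> C i" "i \<le> n" for x i n
    unfolding g_def less_Suc_eq_le using that by (intro Max_ge[OF finM]) auto
  have "\<exists>r. \<forall>k. Q (r k) \<and> r k < r (Suc k) \<and>
      C (r (Suc k)) \<inter> {..<g (r k)} = L \<inter> {..<g (r k)}"
  proof (rule dependent_nat_choice)
    show "\<exists>n. Q n" using lim[of 0] not_finite_existsD by blast
  next
    fix n k :: nat
    have "\<exists>n'>n. n' \<in> {i. C i \<inter> {..<g n} = L \<inter> {..<g n} \<and> Q i}"
      using lim[of "g n"] unfolding infinite_nat_iff_unbounded by blast
    then show "\<exists>n'. Q n' \<and> n < n' \<and> C n' \<inter> {..<g n} = L \<inter> {..<g n}" by blast
  qed
  then obtain r where r: "\<And>k. Q (r k)" "\<And>k. r k < r (Suc k)"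
      "\<And>k. C (r (Suc k)) \<inter> {..<g (r k)} = L \<inter> {..<g (r k)}" by metis
  have mono: "strict_mono r" using r(2) by (simp add: strict_mono_Suc_iff)
  have agree: "x \<in> C (r (Suc k)) \<longleftrightarrow> x \<in> L" if "x < g (r k)" for x k
    using r(3)[of k] that by blast
  have cofinite: "finite {k. x \<notin> C (r k)}" if x: "x \<in> L" for x
  proof (rule finite_subset)
    show "{k. x \<notin> C (r k)} \<subseteq> {..x}"
    proof (rule subsetI, rule ccontr)
      fix k assume k: "k \<in> {k. x \<notin> C (r k)}" "k \<notin> {..x}"
      then obtain k' where k': "k = Suc k'" "x \<le> k'" by (cases k) auto
      have "x \<le> r k'" using k'(2) seq_suble[OF mono, of k'] by linarith
      then have "x < g (r k')" using g_n[of "r k'"] by linarith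
      then show False using agree x k k' by blast
    qed
  qed simp
  have less: "(C (r j) - L) \<inter> (C (r k) - L) = {}" if "j < k" for j k
  proof -
    obtain k' where k': "k = Suc k'" "j \<le> k'" using \<open>j < k\<close> by (metis less_Suc_eq_le not0_implies_Suc not_less0)
    have "r j \<le> r k'" using mono k'(2) by (simp add: strict_mono_less_eq)
    then show ?thesis using g_C agree k'(1) by blast
  qed
  have "(C (r j) - L) \<inter> (C (r k) - L) = {}" if "j \<noteq> k" for j k
    using less[of j k] less[of k j] that by (auto simp: nat_neq_iff)
  with mono r(1) cofinite show thesis by (rule that)
qed

section \<open>Pseudocompactness\<close>

lemma fin_intersecting_MAD_accumulation:
  assumes mad: "MAD_family \<A>" and fi: "fin_intersecting \<A>"
    and C: "\<And>n. finite (C n)" "\<And>n. C n \<noteq> {}"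
  shows "\<exists>H\<in>closed_hyperspace (Psi \<A>).
           \<forall>W. openin (vietoris (Psi \<A>)) W \<and> H \<in> W \<longrightarrow> infinite {n::nat. Inl ` C n \<in> W}"
proof -
  \<comment> \<open>Accumulation along a subsequence is enough.\<close>
  have lift: ?thesis if "strict_mono r"
    and "\<exists>H\<in>closed_hyperspace (Psi \<A>).
       \<forall>W. openin (vietoris (Psi \<A>)) W \<and> H \<in> W \<longrightarrow> infinite {k. Inl ` C (r k) \<in> W}"
    for r :: "nat \<Rightarrow> nat"
  proof -
    have "infinite {n. Inl ` C n \<in> W}" if "infinite {k. Inl ` C (r k) \<in> W}"
      for W :: "(nat + nat set) set set"
    proof
      assume "finite {n. Inl ` C n \<in> W}"
      then have "finite (r -` {n. Inl ` C n \<in> W})"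
        using strict_mono_imp_inj_on[OF \<open>strict_mono r\<close>] by (rule finite_vimageI)
      with that show False by (simp add: vimage_def)
    qed
    with that(2) show ?thesis by blast
  qed
  obtain L where L: "\<And>m. infinite {n. C n \<inter> {..<m} = L \<inter> {..<m}}"
    using infinitely_often_pointwise_limit[of C] by blast
  show ?thesis
  proof (cases "\<forall>m. infinite {n. C n \<inter> {..<m} = L \<inter> {..<m} \<and> C n \<subseteq> L}")
    case True
    then have lim: "infinite {n. C n \<inter> {..<m} = L \<inter> {..<m} \<and> C n \<subseteq> L}" for m by blast
    obtain r :: "nat \<Rightarrow> nat" where r: "strict_mono r" "\<And>k. C (r k) \<subseteq> L"
        "\<And>x. x \<in> L \<Longrightarrow> finite {k. x \<notin> C (r k)}"
      by (rule subsequence_with_disjoint_remainders[OF C(1) lim]) blast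
    show ?thesis
    proof (rule lift[OF r(1)],
        rule vietoris_accumulation_point[where I=UNIV and L=L and G="{}"])
      show "L \<noteq> {} \<or> {} \<noteq> {}" using r(2)[of 0] C(2) by blast
      show "finite {k \<in> UNIV. \<not> Inl ` C (r k) \<subseteq> U}" if "Inl ` L \<subseteq> U"
        for U :: "(nat + nat set) set"
      proof -
        have "{k \<in> UNIV. \<not> Inl ` C (r k) \<subseteq> U} = {}" using r(2) that by blast
        then show ?thesis by simp
      qed
    qed (use C r(3) in auto)
  next
    case False
    then obtain m0 where m0: "finite {n. C n \<inter> {..<m0} = L \<inter> {..<m0} \<and> C n \<subseteq> L}" by blast
    have restrict: "C n \<inter> {..<k} = L \<inter> {..<k}"
      if "C n \<inter> {..<m} = L \<inter> {..<m}" "k \<le> m" for n k m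
    proof -
      have "{..<k} = {..<m} \<inter> {..<k}" using that(2) by auto
      then show ?thesis using that(1) by (metis Int_assoc)
    qed
    \<comment> \<open>Among the sets that agree with \<open>L\<close> below \<open>m0\<close>, only finitely many lie inside \<open>L\<close>.\<close>
    have inf: "infinite {n. C n \<inter> {..<m} = L \<inter> {..<m} \<and> \<not> C n \<subseteq> L}" for m
    proof
      assume "finite {n. C n \<inter> {..<m} = L \<inter> {..<m} \<and> \<not> C n \<subseteq> L}"
      with m0 have "finite ({n. C n \<inter> {..<m0} = L \<inter> {..<m0} \<and> C n \<subseteq> L} \<union>
          {n. C n \<inter> {..<m} = L \<inter> {..<m} \<and> \<not> C n \<subseteq> L})" by blast
      moreover have "{n. C n \<inter> {..<max m0 m} = L \<inter> {..<max m0 m}} \<subseteq>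
          {n. C n \<inter> {..<m0} = L \<inter> {..<m0} \<and> C n \<subseteq> L} \<union>
          {n. C n \<inter> {..<m} = L \<inter> {..<m} \<and> \<not> C n \<subseteq> L}"
        using restrict[of _ "max m0 m" m0] restrict[of _ "max m0 m" m] by auto
      ultimately have "finite {n. C n \<inter> {..<max m0 m} = L \<inter> {..<max m0 m}}"
        by (rule rev_finite_subset)
      with L show False by blast
    qed
    obtain r :: "nat \<Rightarrow> nat" where r: "strict_mono r" "\<And>k. \<not> C (r k) \<subseteq> L"
        "\<And>x. x \<in> L \<Longrightarrow> finite {k. x \<notin> C (r k)}"
        "\<And>j k. j \<noteq> k \<Longrightarrow> (C (r j) - L) \<inter> (C (r k) - L) = {}"
      by (rule subsequence_with_disjoint_remainders[OF C(1) inf]) blast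
    define D where "D k = C (r k) - L" for k
    have D: "finite (D k)" "D k \<noteq> {}" for k
      using C(1) r(2)[of k] by (auto simp: D_def)
    have disj: "D j \<inter> D k = {}" if "j \<noteq> k" for j k
      using r(4)[OF that] by (simp add: D_def)
    have "fin_sequence D" using D disj by (auto simp: fin_sequence_def)
    then obtain I where I: "infinite I"
        and cent: "centered ({{n \<in> I. a \<inter> D n \<noteq> {}} |a. a \<in> \<A>} - Fpow I)"
      using fi unfolding fin_intersecting_def by blast
    define G where "G = {a \<in> \<A>. infinite {n \<in> I. a \<inter> D n \<noteq> {}}}"
    show ?thesis
    proof (rule lift[OF r(1)],
        rule vietoris_accumulation_point[where I=I and L=L and G=G])
      show "finite (C (r k))" "C (r k) \<noteq> {}" for k using C by auto
      show "finite {k \<in> I. x \<notin> C (r k)}" if "x \<in> L" for x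
        using r(3)[OF that] by (rule rev_finite_subset) auto
      show "G \<subseteq> \<A>" by (auto simp: G_def)
      have "infinite {n \<in> I. D n \<noteq> {}}" using I D by simp
      from MAD_family_meets_disjoint_finite_sets[OF mad D(1) disj this]
      have "G \<noteq> {}" by (auto simp: G_def)
      then show "L \<noteq> {} \<or> G \<noteq> {}" ..
      show "finite {k \<in> I. \<not> Inl ` C (r k) \<subseteq> U}"
        if U: "openin (Psi \<A>) U" "Inl ` L \<subseteq> U" "Inr ` G \<subseteq> U" for U
      proof (rule ccontr)
        assume ninf: "infinite {k \<in> I. \<not> Inl ` C (r k) \<subseteq> U}"
        define B where "B k = {x \<in> D k. Inl x \<notin> U}" for k
        have "{k \<in> I. \<not> Inl ` C (r k) \<subseteq> U} = {k \<in> I. B k \<noteq> {}}"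
          using U(2) by (auto simp: B_def D_def)
        then have "infinite {k \<in> I. B k \<noteq> {}}" using ninf by simp
        moreover have "finite (B k)" for k using D(1) by (simp add: B_def)
        moreover have "B j \<inter> B k = {}" if "j \<noteq> k" for j k
          using disj[OF that] by (auto simp: B_def)
        ultimately obtain a where a: "a \<in> \<A>" "infinite {n \<in> I. a \<inter> B n \<noteq> {}}"
            "infinite (a \<inter> (\<Union>n\<in>I. B n))"
          using MAD_family_meets_disjoint_finite_sets[OF mad, of B I] by auto
        have "{n \<in> I. a \<inter> B n \<noteq> {}} \<subseteq> {n \<in> I. a \<inter> D n \<noteq> {}}" by (auto simp: B_def)
        then have "a \<in> G" using a(1,2) by (simp add: G_def infinite_super)
        then have "finite {x \<in> a. Inl x \<notin> U}"
          using U by (intro openin_Psi_Inr_almost_contains) auto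
        moreover have "a \<inter> (\<Union>n\<in>I. B n) \<subseteq> {x \<in> a. Inl x \<notin> U}" by (auto simp: B_def)
        ultimately have "finite (a \<inter> (\<Union>n\<in>I. B n))" by (rule rev_finite_subset)
        with a(3) show False ..
      qed
      show "infinite {k \<in> I. \<forall>a\<in>\<F>. a \<inter> C (r k) - K \<noteq> {}}"
        if F: "finite \<F>" "\<F> \<subseteq> G" and K: "finite K" for \<F> K
      proof -
        have inf: "infinite {k \<in> I. \<forall>a\<in>\<F>. a \<inter> D k \<noteq> {}}"
        proof (cases "\<F> = {}")
          case True
          then show ?thesis using I by simp
        next
          case False
          define \<S> where "\<S> = (\<lambda>a. {n \<in> I. a \<inter> D n \<noteq> {}}) ` \<F>"
          have "finite \<S>" "\<S> \<noteq> {}" using F False by (auto simp: \<S>_def)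
          moreover have "\<S> \<subseteq> {{n \<in> I. a \<inter> D n \<noteq> {}} |a. a \<in> \<A>} - Fpow I"
            using F(2) by (auto simp: \<S>_def G_def Fpow_def)
          ultimately have "infinite (\<Inter>\<S>)" using cent unfolding centered_def by blast
          moreover have "\<Inter>\<S> = {k \<in> I. \<forall>a\<in>\<F>. a \<inter> D k \<noteq> {}}"
            using False by (auto simp: \<S>_def)
          ultimately show ?thesis by simp
        qed
        \<comment> \<open>By disjointness every point of \<open>K\<close> lies in at most one \<open>D k\<close>.\<close>
        have "finite (\<Union>x\<in>K. {k. x \<in> D k})"
        proof (rule finite_UN_I[OF K])
          fix x
          have "j = k" if "x \<in> D j" "x \<in> D k" for j k using disj that by blast
          then show "finite {k. x \<in> D k}"
            by (metis (mono_tags, lifting) finite.simps finite_subset insertCI mem_Collect_eq subsetI)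
        qed
        with inf have "infinite ({k \<in> I. \<forall>a\<in>\<F>. a \<inter> D k \<noteq> {}} - (\<Union>x\<in>K. {k. x \<in> D k}))"
          by simp
        moreover have "{k \<in> I. \<forall>a\<in>\<F>. a \<inter> D k \<noteq> {}} - (\<Union>x\<in>K. {k. x \<in> D k}) \<subseteq>
            {k \<in> I. \<forall>a\<in>\<F>. a \<inter> C (r k) - K \<noteq> {}}"
          by (fastforce simp: D_def)
        ultimately show ?thesis by (rule infinite_super[rotated])
      qed
    qed
  qed
qed

theorem proposition10:
  fixes \<A> :: "nat set set"
  assumes "MAD_family \<A>" and "fin_intersecting \<A>"
  shows "pseudocompact_family \<A>"
  unfolding pseudocompact_family_def pseudocompact_space_def
proof (intro allI impI)
  let ?X = "vietoris (Psi \<A>)"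
  fix f assume f: "continuous_map ?X euclideanreal f"
  have inf: "\<And>a. a \<in> \<A> \<Longrightarrow> infinite a"
    using assms(1) by (simp add: MAD_family_def almost_disjoint_family_def)
  show "bounded (f ` topspace ?X)"
  proof (rule ccontr)
    assume unb: "\<not> bounded (f ` topspace ?X)"
    have "\<exists>F. (finite F \<and> F \<noteq> {}) \<and> \<bar>f (Inl ` F)\<bar> > real n" for n
    proof -
      define W where "W = {H \<in> topspace ?X. f H \<in> {y. \<bar>y\<bar> > real n}}"
      have "open {y::real. \<bar>y\<bar> > real n}" by (intro open_Collect_less continuous_intros)
      then have "openin ?X W"
        unfolding W_def using f by (intro openin_continuous_map_preimage) auto
      moreover have "W \<noteq> {}"
      proof
        assume "W = {}"
        then have "\<forall>y\<in>f ` topspace ?X. norm y \<le> real n" by (auto simp: W_def not_less)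
        then show False using unb boundedI by blast
      qed
      ultimately obtain F where "finite F" "F \<noteq> {}" "Inl ` F \<in> W"
        using finite_subsets_of_omega_dense[OF inf] by blast
      then show ?thesis by (auto simp: W_def)
    qed
    then obtain C where C: "\<And>n. finite (C n)" "\<And>n. C n \<noteq> {}"
        "\<And>n. \<bar>f (Inl ` C n)\<bar> > real n" by metis
    obtain H where H: "H \<in> closed_hyperspace (Psi \<A>)"
        "\<forall>W. openin ?X W \<and> H \<in> W \<longrightarrow> infinite {n. Inl ` C n \<in> W}"
      using fin_intersecting_MAD_accumulation[OF assms C(1,2)] by (rule bexE)
    define W where "W = {F \<in> topspace ?X. f F \<in> {y. \<bar>y\<bar> < \<bar>f H\<bar> + 1}}"
    have "open {y::real. \<bar>y\<bar> < \<bar>f H\<bar> + 1}" by (intro open_Collect_less continuous_intros)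
    then have "openin ?X W"
      unfolding W_def using f by (intro openin_continuous_map_preimage) auto
    moreover have "H \<in> W" using H(1) by (simp add: W_def topspace_vietoris)
    ultimately have "infinite {n. Inl ` C n \<in> W}" using H(2) by simp
    moreover have "{n. Inl ` C n \<in> W} \<subseteq> {..nat \<lceil>\<bar>f H\<bar> + 1\<rceil>}"
    proof
      fix n assume "n \<in> {n. Inl ` C n \<in> W}"
      then have "real n < \<bar>f H\<bar> + 1" using C(3)[of n] by (auto simp: W_def)
      then show "n \<in> {..nat \<lceil>\<bar>f H\<bar> + 1\<rceil>}" by simp linarith
    qed
    then have "finite {n. Inl ` C n \<in> W}" by (rule finite_subset) simp
    ultimately show False by (rule notE)
  qed
qed

end
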